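(* Let $P_4(x,H,F)=F^6+A_5F^5+A_4F^4+A_3F^3+A_2F^2+A_1F+A_0$ be the monic sextic in $F$ with coefficients $A_i\in\mathbb Q[x,H]$ listed in the context. Then $$\operatorname{Disc}_FP_4=3^{-64}H^4x^6\,\mathcal A_4(x^3,9H)^3\,\mathcal B_4(x^3,H)^2,$$ where $$\mathcal A_4(X,Y)=(\sigma_1^2-4\sigma_2)^2-128\sigma_1\sigma_3,\qquad \sigma_1=X+Y-1,\ \sigma_2=XY-X-Y,\ \sigma_3=-XY,$$ $$\begin{aligned}\mathcal B_4(X,H)={}&(X-1)(X+1)^4+18H(11X^4-260X^3+482X^2-260X+11)\\&+81H^2(145X^3+1809X^2-1809X-145)+5832H^3(19X^2-387X+19)\\&+5458752H^4(1-X)+30233088H^5.\end{aligned}$$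
   Context: $\operatorname{Disc}_F$ is the discriminant with respect to $F$. The coefficients are $$A_5=\frac{(1+x)(x^2+5x+1)}9-2H,$$ $$A_4=\frac{x^6+15x^5+60x^4+83x^3+60x^2+15x+1}{243}-\frac{2}{27}(3x^3+15x^2+15x+2)H+\frac43H^2,$$ $$\begin{aligned}A_3={}&\frac{(1+x)^3}{19683}(x^6+33x^5+204x^4+263x^3+204x^2+33x+1)\\&-\frac{2H}{729}(3x^6+36x^5+126x^4+166x^3+114x^2+24x+1)\\&+\frac{3x^3+48x^2+48x-5}{81}H^2-\frac8{27}H^3,\end{aligned}$$ $$\begin{aligned}A_2={}&\frac{x(1+x)^6}{59049}(x^4+13x^3+15x^2+13x+1)\\&-\frac{2x(1+x)^2}{19683}(x^6+25x^5+138x^4+241x^3+226x^2+99x+9)H\\&+\frac{x}{2187}(12x^5+27x^4+243x^3+422x^2+171x-45)H^2+\frac{2x(23x^2-12x-12)}{243}H^3,\end{aligned}$$ $$\begin{aligned}A_1={}&\frac{x^2(1+x)^9(x^2+x+1)}{531441}-\frac{2x^2(1+x)^5}{177147}(2x^4+19x^3+29x^2+27x+9)H\\&+\frac{x^2(1+x)}{59049}(4x^6+68x^5+85x^4+729x^3+588x^2+513x-135)H^2\\&-\frac{4x^2}{6561}(2x^4-69x^3-51x^2+45x+18)H^3-\frac{4x^3}{27}H^4,\end{aligned}$$ $$\begin{aligned}A_0={}&-\frac{2x^3(1+x)^8(x^2+x+1)}{1594323}H+\frac{x^3(1+x)^4}{531441}(4x^4+24x^3+57x^2+57x+33)H^2\\&-\frac{2x^3}{531441}(4x^6+36x^5-585x^4+324x^3-135x^2+486x-486)H^3\\&-\frac{x^3(36x^2+36x-31)}{2187}H^4+\frac{8x^3}{243}H^5.\end{aligned}$$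 *)

theory Defs
  imports "Subresultants.Resultant_Prelim"
begin

text \<open>
  The discriminant of a polynomial of degree \<open>n\<close> with leading coefficient \<open>a\<close>:
  \<open>(-1)^(n (n - 1) / 2) Res (p, p') / a\<close>. The division by \<open>a\<close> is exact. Characteristic zero
  guarantees that \<open>p'\<close> has degree \<open>n - 1\<close>, so that the resultant is the determinant of the
  Sylvester matrix of the expected size \<open>2 n - 1\<close>.
\<close>

definition discriminant :: "'a :: {idom_divide, ring_char_0} poly \<Rightarrow> 'a" where
  "discriminant p =
     (-1) ^ (degree p * (degree p - 1) div 2) * (resultant p (pderiv p) div lead_coeff p)"

text \<open>
  \<open>\<rat>[x, H]\<close> is represented as \<open>\<rat>[x][H]\<close>, that is, the inner polynomial variable is \<open>x\<close> and the
  outer one is \<open>H\<close>. The variable \<open>F\<close> of the sextic is then the outermost variable of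
  \<^typ>\<open>rat poly poly poly\<close>.
\<close>

type_synonym rat_poly_xH = "rat poly poly"

definition var_x :: rat_poly_xH where
  "var_x = [:[:0, 1:]:]"

definition var_H :: rat_poly_xH where
  "var_H = [:0, 1:]"

definition const :: "rat \<Rightarrow> rat_poly_xH" where
  "const q = [:[:q:]:]"

definition coeff_A5 :: "rat_poly_xH \<Rightarrow> rat_poly_xH \<Rightarrow> rat_poly_xH" where
  "coeff_A5 x H = const (1/9) * (1 + x) * (x^2 + 5*x + 1) - 2*H"

definition coeff_A4 :: "rat_poly_xH \<Rightarrow> rat_poly_xH \<Rightarrow> rat_poly_xH" where
  "coeff_A4 x H =
     const (1/243) * (x^6 + 15*x^5 + 60*x^4 + 83*x^3 + 60*x^2 + 15*x + 1)
     - const (2/27) * (3*x^3 + 15*x^2 + 15*x + 2) * H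
     + const (4/3) * H^2"

definition coeff_A3 :: "rat_poly_xH \<Rightarrow> rat_poly_xH \<Rightarrow> rat_poly_xH" where
  "coeff_A3 x H =
     const (1/19683) * (1 + x)^3 *
       (x^6 + 33*x^5 + 204*x^4 + 263*x^3 + 204*x^2 + 33*x + 1)
     - const (2/729) * H *
       (3*x^6 + 36*x^5 + 126*x^4 + 166*x^3 + 114*x^2 + 24*x + 1)
     + const (1/81) * (3*x^3 + 48*x^2 + 48*x - 5) * H^2
     - const (8/27) * H^3"

definition coeff_A2 :: "rat_poly_xH \<Rightarrow> rat_poly_xH \<Rightarrow> rat_poly_xH" where
  "coeff_A2 x H =
     const (1/59049) * x * (1 + x)^6 * (x^4 + 13*x^3 + 15*x^2 + 13*x + 1)
     - const (2/19683) * x * (1 + x)^2 *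
       (x^6 + 25*x^5 + 138*x^4 + 241*x^3 + 226*x^2 + 99*x + 9) * H
     + const (1/2187) * x *
       (12*x^5 + 27*x^4 + 243*x^3 + 422*x^2 + 171*x - 45) * H^2
     + const (2/243) * x * (23*x^2 - 12*x - 12) * H^3"

definition coeff_A1 :: "rat_poly_xH \<Rightarrow> rat_poly_xH \<Rightarrow> rat_poly_xH" where
  "coeff_A1 x H =
     const (1/531441) * x^2 * (1 + x)^9 * (x^2 + x + 1)
     - const (2/177147) * x^2 * (1 + x)^5 *
       (2*x^4 + 19*x^3 + 29*x^2 + 27*x + 9) * H
     + const (1/59049) * x^2 * (1 + x) *
       (4*x^6 + 68*x^5 + 85*x^4 + 729*x^3 + 588*x^2 + 513*x - 135) * H^2
     - const (4/6561) * x^2 * (2*x^4 - 69*x^3 - 51*x^2 + 45*x + 18) * H^3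
     - const (4/27) * x^3 * H^4"

definition coeff_A0 :: "rat_poly_xH \<Rightarrow> rat_poly_xH \<Rightarrow> rat_poly_xH" where
  "coeff_A0 x H =
     - const (2/1594323) * x^3 * (1 + x)^8 * (x^2 + x + 1) * H
     + const (1/531441) * x^3 * (1 + x)^4 *
       (4*x^4 + 24*x^3 + 57*x^2 + 57*x + 33) * H^2
     - const (2/531441) * x^3 *
       (4*x^6 + 36*x^5 - 585*x^4 + 324*x^3 - 135*x^2 + 486*x - 486) * H^3
     - const (1/2187) * x^3 * (36*x^2 + 36*x - 31) * H^4
     + const (8/243) * x^3 * H^5"

definition P4 :: "rat_poly_xH poly" where
  "P4 = [:coeff_A0 var_x var_H, coeff_A1 var_x var_H, coeff_A2 var_x var_H,
          coeff_A3 var_x var_H, coeff_A4 var_x var_H, coeff_A5 var_x var_H, 1:]"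

definition cal_A4 :: "'a :: comm_ring_1 \<Rightarrow> 'a \<Rightarrow> 'a" where
  "cal_A4 X Y =
     (let \<sigma>1 = X + Y - 1; \<sigma>2 = X*Y - X - Y; \<sigma>3 = - (X*Y)
      in (\<sigma>1^2 - 4*\<sigma>2)^2 - 128*\<sigma>1*\<sigma>3)"

definition cal_B4 :: "'a :: comm_ring_1 \<Rightarrow> 'a \<Rightarrow> 'a" where
  "cal_B4 X H =
     (X - 1) * (X + 1)^4
     + 18*H * (11*X^4 - 260*X^3 + 482*X^2 - 260*X + 11)
     + 81*H^2 * (145*X^3 + 1809*X^2 - 1809*X - 145)
     + 5832*H^3 * (19*X^2 - 387*X + 19)
     + 5458752*H^4 * (1 - X)
     + 30233088*H^5"

end

theory Submission
  imports Defs "HOL-Computational_Algebra.Fundamental_Theorem_Algebra"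
begin

text \<open>
  Idea. Put \<open>X = x^3\<close> and \<open>Y = 9 H\<close>. The surface \<open>P4 = 0\<close> is the tangent developable of a rational
  quartic curve, and its six sheets over \<open>(X, Y)\<close> correspond to the six roots \<open>t\<close> of
  \<open>h(t) = X (1 + t)^3 + Y t^3 (1 + t)^3 + t^3\<close> via \<open>\<kappa> = X / t^3 + Y + 3 Y t\<close>, where
  \<open>\<kappa> = - 27 F - (1 + x)^3\<close>. Modulo \<open>h\<close>, each \<open>t^3 \<kappa>^i\<close> with \<open>i < 6\<close> is a combination of
  \<open>1, t, \<dots>, t^5\<close>; the determinant of the resulting \<open>6 \<times> 6\<close> matrix is \<open>3^6 X^3 Y^3 A4 B4\<close>. It relates
  the Vandermonde determinants of the \<open>\<kappa>\<close>'s and of the \<open>t\<close>'s, so it remains to find the discriminant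
  of \<open>h\<close>. That one contributes a further factor \<open>A4\<close>: on \<open>h = 0\<close> one has
  \<open>t h'(t) = 3 (1 + t)^2 (Y t^4 - X)\<close>, and if \<open>X = Y z^4\<close> then \<open>h(z) = z^3 (Y (1 + z)^4 + 1)\<close>.
  All this is done at generic rational points \<open>(x, H)\<close>, which is enough by density.
\<close>

subsection \<open>Vandermonde matrices, resultants and discriminants\<close>

definition vandermonde_mat :: "nat \<Rightarrow> (nat \<Rightarrow> 'a) \<Rightarrow> 'a :: comm_ring_1 mat" where
  "vandermonde_mat n r = mat n n (\<lambda>(i, j). r j ^ i)"

text \<open>Descending powers match the Sylvester matrix, whose rows list coefficients from the top
  degree down.\<close>

definition rev_vandermonde_mat :: "nat \<Rightarrow> (nat \<Rightarrow> 'a) \<Rightarrow> 'a :: comm_ring_1 mat" where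
  "rev_vandermonde_mat n r = mat n n (\<lambda>(i, j). r j ^ (n - 1 - i))"

definition exchange_mat :: "nat \<Rightarrow> 'a :: comm_ring_1 mat" where
  "exchange_mat n = mat n n (\<lambda>(i, j). if i + j = n - 1 then 1 else 0)"

lemma vandermonde_mat_carrier [simp]:
  "vandermonde_mat n r \<in> carrier_mat n n"
  "rev_vandermonde_mat n r \<in> carrier_mat n n"
  "exchange_mat n \<in> carrier_mat n n"
  by (auto simp: vandermonde_mat_def rev_vandermonde_mat_def exchange_mat_def)

lemma index_exchange_mat_mult:
  assumes A: "A \<in> carrier_mat n k" and i: "i < n" and j: "j < k"
  shows "(exchange_mat n * A) $$ (i, j) = A $$ (n - 1 - i, j)"
proof -
  have "(exchange_mat n * A) $$ (i, j)
      = (\<Sum>l\<in>{0..<n}. (if i + l = n - 1 then 1 else 0) * A $$ (l, j))"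
    using A i j by (auto simp: exchange_mat_def scalar_prod_def)
  also have "\<dots> = (\<Sum>l\<in>{0..<n}. if l = n - 1 - i then A $$ (l, j) else 0)"
    using i by (intro sum.cong) auto
  also have "\<dots> = A $$ (n - 1 - i, j)"
    using i by (subst sum.delta) auto
  finally show ?thesis .
qed

lemma rev_vandermonde_mat_eq:
  "rev_vandermonde_mat n r = exchange_mat n * vandermonde_mat n r"
proof (rule eq_matI)
  fix i j assume "i < dim_row (exchange_mat n * vandermonde_mat n r)"
    "j < dim_col (exchange_mat n * vandermonde_mat n r)"
  hence "i < n" "j < n" by (auto simp: exchange_mat_def vandermonde_mat_def)
  thus "rev_vandermonde_mat n r $$ (i, j) = (exchange_mat n * vandermonde_mat n r) $$ (i, j)"
    by (subst index_exchange_mat_mult[of _ n n])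
       (auto simp: rev_vandermonde_mat_def vandermonde_mat_def)
qed (auto simp: rev_vandermonde_mat_def exchange_mat_def vandermonde_mat_def)

lemma det_rev_vandermonde_mat:
  "det (rev_vandermonde_mat n r) = det (exchange_mat n) * det (vandermonde_mat n r)"
  unfolding rev_vandermonde_mat_eq by (rule det_mult[of _ n]) auto

text \<open>Reversal is an involution, so its determinant is a unit. Its sign need not be computed:
  it enters both products of derivatives below in the same way.\<close>

lemma det_exchange_mat_square: "det (exchange_mat n) * det (exchange_mat n) = (1 :: 'a :: comm_ring_1)"
proof -
  have "exchange_mat n * exchange_mat n = (1\<^sub>m n :: 'a mat)"
  proof (rule eq_matI)
    fix i j assume "i < dim_row (1\<^sub>m n :: 'a mat)" "j < dim_col (1\<^sub>m n :: 'a mat)"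
    thus "(exchange_mat n * exchange_mat n) $$ (i, j) = (1\<^sub>m n :: 'a mat) $$ (i, j)"
      by (subst index_exchange_mat_mult[of _ n n]) (auto simp: exchange_mat_def)
  qed (auto simp: exchange_mat_def)
  hence "det (exchange_mat n * exchange_mat n) = (1 :: 'a)" by simp
  thus ?thesis by (subst (asm) det_mult[of _ n]) auto
qed

section \<open>Resultants as products over roots\<close>

lemma poly_eq_sum_rev:
  fixes p :: "'a :: comm_semiring_1 poly"
  assumes "degree p < N"
  shows "poly p z = (\<Sum>j<N. coeff p (N - 1 - j) * z ^ (N - 1 - j))"
proof -
  have "poly p z = (\<Sum>i\<le>degree p. coeff p i * z ^ i)" by (rule poly_altdef)
  also have "\<dots> = (\<Sum>i<N. coeff p i * z ^ i)"
    using assms by (intro sum.mono_neutral_left) (auto simp: coeff_eq_0)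
  also have "\<dots> = (\<Sum>j<N. coeff p (N - 1 - j) * z ^ (N - 1 - j))"
    by (rule sum.reindex_bij_witness[of _ "\<lambda>j. N - 1 - j" "\<lambda>j. N - 1 - j"]) auto
  finally show ?thesis .
qed

text \<open>Row \<open>i\<close> lists the coefficients of \<open>p\<close> or \<open>q\<close>
  times a power of the variable; pairing it with the descending powers of \<open>z\<close> evaluates
  that multiple.\<close>

lemma sylvester_mat_row_eval:
  fixes p q :: "'a :: idom poly"
  assumes i: "i < degree p + degree q"
  shows "(\<Sum>j<degree p + degree q. sylvester_mat p q $$ (i, j) * z ^ (degree p + degree q - 1 - j))
    = (if i < degree q then z ^ (degree q - 1 - i) * poly p z
       else z ^ (degree p + degree q - 1 - i) * poly q z)"
proof -
  define N where "N = degree p + degree q"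
  define f where "f = (if i < degree q then monom 1 (degree q - 1 - i) * p
    else monom 1 (N - 1 - i) * q)"
  have entry: "sylvester_mat p q $$ (i, j) = coeff f (N - 1 - j)" if "j < N" for j
    using that i unfolding N_def f_def
    by (subst sylvester_index_mat) (auto simp: coeff_monom_mult coeff_eq_0 N_def)
  have "degree f < N"
  proof (cases "i < degree q")
    case True
    hence "degree f \<le> degree q - 1 - i + degree p"
      using degree_mult_le[of "monom 1 (degree q - 1 - i)" p]
        degree_monom_le[of "1 :: 'a" "degree q - 1 - i"] by (simp add: f_def)
    with True show ?thesis by (simp add: N_def)
  next
    case False
    hence "degree f \<le> N - 1 - i + degree q"
      using degree_mult_le[of "monom 1 (N - 1 - i)" q]
        degree_monom_le[of "1 :: 'a" "N - 1 - i"] by (simp add: f_def)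
    with False i show ?thesis by (simp add: N_def)
  qed
  hence "poly f z = (\<Sum>j<N. coeff f (N - 1 - j) * z ^ (N - 1 - j))"
    by (rule poly_eq_sum_rev)
  also have "\<dots> = (\<Sum>j<N. sylvester_mat p q $$ (i, j) * z ^ (N - 1 - j))"
    by (intro sum.cong) (simp_all add: entry)
  finally show ?thesis by (simp add: f_def N_def poly_monom split: if_splits)
qed

text \<open>
  Multiply the Sylvester matrix by a matrix whose last columns are the power vectors of the roots:
  the rows coming from \<open>p\<close> vanish on them, and those coming from \<open>q\<close> are scaled by the values of \<open>q\<close>.
\<close>

lemma resultant_eq_prod_roots:
  fixes p q :: "'a :: idom poly"
  assumes monic: "monic p" and roots: "\<And>i. i < degree p \<Longrightarrow> poly p (r i) = 0"
    and nz: "det (vandermonde_mat (degree p) r) \<noteq> 0"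
  shows "resultant p q = (\<Prod>i<degree p. poly q (r i))"
proof -
  define m n N where "m = degree p" and "n = degree q" and "N = m + n"
  let ?S = "sylvester_mat p q"
  define Z where "Z = mat N N (\<lambda>(i, j). if j < n then if i = j then 1 else 0
    else r (j - n) ^ (N - 1 - i))"
  define A where "A = mat n n (\<lambda>(i, j). ?S $$ (i, j))"
  define C where "C = mat m n (\<lambda>(i, j). ?S $$ (n + i, j))"
  define B where "B = mat n m (\<lambda>(i, j). r j ^ (N - 1 - i))"
  define V where "V = rev_vandermonde_mat m r"
  define E where "E = mat_diag m (\<lambda>i. poly q (r i))"
  have Scar: "?S \<in> carrier_mat N N"
    using sylvester_carrier_mat[of p q] by (simp add: N_def m_def n_def)
  have Ncom: "degree p + degree q = N" by (simp add: N_def m_def n_def)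
  have Z_block: "Z = four_block_mat (1\<^sub>m n) B (0\<^sub>m m n) V"
    by (rule eq_matI) (auto simp: Z_def B_def V_def rev_vandermonde_mat_def N_def
        intro!: arg_cong[where f = "(^) _"])
  have SZ_block: "?S * Z = four_block_mat A (0\<^sub>m n m) C (V * E)"
  proof (rule eq_matI)
    fix i j assume "i < dim_row (four_block_mat A (0\<^sub>m n m) C (V * E))"
      "j < dim_col (four_block_mat A (0\<^sub>m n m) C (V * E))"
    hence i: "i < N" and j: "j < N" by (auto simp: A_def V_def rev_vandermonde_mat_def E_def mat_diag_def N_def)
    have "(?S * Z) $$ (i, j) = (\<Sum>k<N. ?S $$ (i, k) * Z $$ (k, j))"
      using i j Scar by (auto simp: Z_def scalar_prod_def atLeast0LessThan intro!: sum.cong)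
    also have "\<dots> = four_block_mat A (0\<^sub>m n m) C (V * E) $$ (i, j)"
    proof (cases "j < n")
      case True
      hence "(\<Sum>k<N. ?S $$ (i, k) * Z $$ (k, j)) = (\<Sum>k<N. if k = j then ?S $$ (i, k) else 0)"
        using j by (intro sum.cong) (auto simp: Z_def)
      also have "\<dots> = ?S $$ (i, j)" using j by simp
      finally show ?thesis using i j True
        by (auto simp: A_def C_def V_def rev_vandermonde_mat_def E_def mat_diag_def N_def)
    next
      case False
      hence "(\<Sum>k<N. ?S $$ (i, k) * Z $$ (k, j)) = (\<Sum>k<N. ?S $$ (i, k) * r (j - n) ^ (N - 1 - k))"
        using j by (intro sum.cong) (auto simp: Z_def)
      also have "\<dots> = (if i < n then 0 else r (j - n) ^ (N - 1 - i) * poly q (r (j - n)))"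
        using sylvester_mat_row_eval[of i p q "r (j - n)"] i j False roots[of "j - n"]
        unfolding Ncom by (auto simp: N_def m_def n_def)
      also have "\<dots> = four_block_mat A (0\<^sub>m n m) C (V * E) $$ (i, j)"
        using i j False unfolding E_def
        by (subst mat_diag_mult_right[of _ m])
           (auto simp: A_def C_def V_def rev_vandermonde_mat_def mat_diag_def N_def)
      finally show ?thesis .
    qed
    finally show "(?S * Z) $$ (i, j) = four_block_mat A (0\<^sub>m n m) C (V * E) $$ (i, j)" .
  qed (use Scar in \<open>auto simp: Z_def A_def V_def rev_vandermonde_mat_def E_def mat_diag_def N_def\<close>)
  have "det A = 1"
  proof -
    have "upper_triangular A"
      by (rule upper_triangularI) (auto simp: A_def sylvester_index_mat n_def)
    hence "det A = prod_list (diag_mat A)" by (rule det_upper_triangular[of _ n]) (simp add: A_def)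
    also have "\<dots> = (\<Prod>i = 0..<n. 1)" unfolding prod_list_diag_prod
      using monic by (intro prod.cong) (auto simp: A_def sylvester_index_mat n_def)
    finally show ?thesis by simp
  qed
  have detV: "det V \<noteq> 0"
  proof
    assume "det V = 0"
    hence "det (exchange_mat m) * det V = (0 :: 'a)" by simp
    hence "det (vandermonde_mat m r) = 0"
      unfolding V_def det_rev_vandermonde_mat mult.assoc[symmetric] det_exchange_mat_square by simp
    with nz show False by (simp add: m_def)
  qed
  have "det Z = det V" unfolding Z_block
    by (subst det_four_block_mat_lower_left_zero[of _ n _ m]) (auto simp: B_def V_def)
  hence "det ?S * det V = det (?S * Z)"
    by (subst det_mult[of _ N]) (use Scar in \<open>auto simp: Z_def\<close>)
  also have "\<dots> = det A * det (V * E)" unfolding SZ_block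
    by (rule det_four_block_mat_upper_right_zero[of _ n _ m])
       (auto simp: A_def C_def V_def E_def intro!: mult_carrier_mat[of _ m m])
  also have "\<dots> = det V * det E"
    using \<open>det A = 1\<close> by (subst det_mult[of _ m]) (auto simp: V_def E_def)
  also have "det E = (\<Prod>i<m. poly q (r i))"
    unfolding E_def by (subst det_upper_triangular[of _ m])
      (auto simp: mat_diag_def prod_list_diag_prod atLeast0LessThan intro!: upper_triangularI)
  finally show ?thesis using detV by (simp add: resultant_def m_def mult.commute)
qed

section \<open>The Bezout form and derivatives at roots\<close>

lemma bezout_sum_diff:
  fixes p :: "'a :: comm_ring_1 poly"
  assumes n: "degree p = n"
  shows "(z - w) * (\<Sum>i<n. \<Sum>j<n. coeff p (Suc (i + j)) * z ^ i * w ^ j) = poly p z - poly p w"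
proof (cases "n = 0")
  case True
  then obtain c where "p = [:c:]" using n degree_eq_zeroE by blast
  with True show ?thesis by simp
next
  case False
  \<comment> \<open>\<open>z\<close> times the summand is \<open>f (Suc i) j\<close>, and
    \<open>w\<close> times it is \<open>f i (Suc j)\<close>. Both shifted sums differ from the sum
    of \<open>f\<close> by boundary terms only, so the interior cancels.\<close>
  define f where "f i j = coeff p (i + j) * z ^ i * w ^ j" for i j
  have f0: "f i j = 0" if "i + j > n" for i j
    using that n by (simp add: f_def coeff_eq_0)
  have z: "(\<Sum>i<n. \<Sum>j<n. f (Suc i) j) + (\<Sum>j<n. f 0 j) = (\<Sum>i<n. \<Sum>j<n. f i j) + (\<Sum>j<n. f n j)"
  proof -
    have "(\<Sum>i<Suc n. \<Sum>j<n. f i j) = (\<Sum>j<n. f 0 j) + (\<Sum>i<n. \<Sum>j<n. f (Suc i) j)"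
      by (rule sum.lessThan_Suc_shift)
    thus ?thesis by simp
  qed
  have w: "(\<Sum>i<n. \<Sum>j<n. f i (Suc j)) + (\<Sum>i<n. f i 0) = (\<Sum>i<n. \<Sum>j<n. f i j) + (\<Sum>i<n. f i n)"
  proof -
    have "(\<Sum>i<n. \<Sum>j<Suc n. f i j) = (\<Sum>i<n. f i 0 + (\<Sum>j<n. f i (Suc j)))"
      by (intro sum.cong refl sum.lessThan_Suc_shift)
    thus ?thesis by (simp add: sum.distrib)
  qed
  \<comment> \<open>In the upper boundary row and column only one term has
    \<open>i + j \<le> n\<close>; the others carry a coefficient beyond the degree.\<close>
  have "(\<Sum>j<n. f n j) = (\<Sum>j<n. if j = 0 then f n 0 else 0)"
    by (intro sum.cong) (auto simp: f0)
  hence fn: "(\<Sum>j<n. f n j) = f n 0" using False by simp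
  have "(\<Sum>i<n. f i n) = (\<Sum>i<n. if i = 0 then f 0 n else 0)"
    by (intro sum.cong) (auto simp: f0)
  hence nf: "(\<Sum>i<n. f i n) = f 0 n" using False by simp
  have pz: "poly p z = (\<Sum>i<n. f i 0) + f n 0"
    by (simp add: poly_altdef n f_def flip: lessThan_Suc_atMost)
  have pw: "poly p w = (\<Sum>j<n. f 0 j) + f 0 n"
    by (simp add: poly_altdef n f_def flip: lessThan_Suc_atMost)
  have "(z - w) * (\<Sum>i<n. \<Sum>j<n. coeff p (Suc (i + j)) * z ^ i * w ^ j)
      = (\<Sum>i<n. \<Sum>j<n. f (Suc i) j) - (\<Sum>i<n. \<Sum>j<n. f i (Suc j))"
    by (simp add: f_def sum_distrib_left sum_subtractf[symmetric] algebra_simps)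
  also have "\<dots> = poly p z - poly p w"
    using z w unfolding fn nf pz pw by (simp add: algebra_simps)
  finally show ?thesis .
qed

text \<open>With \<open>Q\<close> the Bezout sum as a polynomial in \<open>w\<close>,
  \<open>p = (w - z) * Q + p(z)\<close>; differentiating and setting \<open>w = z\<close> leaves
  \<open>Q(z)\<close>.\<close>

lemma bezout_sum_diagonal:
  fixes p :: "'a :: {idom, ring_char_0} poly"
  assumes n: "degree p = n"
  shows "(\<Sum>i<n. \<Sum>j<n. coeff p (Suc (i + j)) * z ^ i * z ^ j) = poly (pderiv p) z"
proof -
  define Q where "Q = (\<Sum>j<n. monom (\<Sum>i<n. coeff p (Suc (i + j)) * z ^ i) j)"
  have Q: "poly Q w = (\<Sum>i<n. \<Sum>j<n. coeff p (Suc (i + j)) * z ^ i * w ^ j)" for w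
    by (subst sum.swap) (simp add: Q_def poly_sum poly_monom sum_distrib_right)
  have "poly p w = poly ([:- z, 1:] * Q + [:poly p z:]) w" for w
    using bezout_sum_diff[OF n, of z w] unfolding Q[symmetric] by (simp add: algebra_simps)
  hence "p = [:- z, 1:] * Q + [:poly p z:]"
    by (subst poly_eq_poly_eq_iff[symmetric]) (rule ext)
  hence "pderiv p = pderiv ([:- z, 1:] * Q + [:poly p z:])" by simp
  hence "poly (pderiv p) z = poly Q z"
    by (simp add: pderiv_add pderiv_diff pderiv_smult pderiv_pCons)
  thus ?thesis by (simp add: Q)
qed

text \<open>
  The Bezout form \<open>(p(z) - p(w)) / (z - w)\<close> becomes diagonal when evaluated at the roots of \<open>p\<close>.
  Its matrix \<open>C\<close> below has its columns reversed, which makes it triangular.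
\<close>

lemma prod_pderiv_roots:
  fixes p :: "'a :: {idom, ring_char_0} poly"
  assumes n: "degree p = n" and roots: "\<And>i. i < n \<Longrightarrow> poly p (r i) = 0"
    and inj: "inj_on r {..<n}"
  shows "(\<Prod>i<n. poly (pderiv p) (r i))
    = lead_coeff p ^ n * det (exchange_mat n) * det (vandermonde_mat n r) ^ 2"
proof -
  define C where "C = mat n n (\<lambda>(i, j). coeff p (i + n - j))"
  let ?V = "vandermonde_mat n r" and ?W = "rev_vandermonde_mat n r"
  have CW: "(C * ?W) $$ (i, k) = (\<Sum>j<n. coeff p (Suc (i + j)) * r k ^ j)"
    if "i < n" "k < n" for i k
  proof -
    have "(C * ?W) $$ (i, k) = (\<Sum>j<n. coeff p (i + n - j) * r k ^ (n - 1 - j))"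
      using that by (simp add: C_def rev_vandermonde_mat_def scalar_prod_def atLeast0LessThan)
    also have "\<dots> = (\<Sum>j<n. coeff p (Suc (i + j)) * r k ^ j)"
      by (rule sum.reindex_bij_witness[of _ "\<lambda>j. n - 1 - j" "\<lambda>j. n - 1 - j"])
         (auto simp: Suc_diff_Suc intro!: arg_cong[where f = "coeff p"])
    finally show ?thesis .
  qed
  have "?V\<^sup>T * (C * ?W) = mat_diag n (\<lambda>i. poly (pderiv p) (r i))"
  proof (rule eq_matI)
    fix m k assume "m < dim_row (mat_diag n (\<lambda>i. poly (pderiv p) (r i)))"
      "k < dim_col (mat_diag n (\<lambda>i. poly (pderiv p) (r i)))"
    hence m: "m < n" and k: "k < n" by (auto simp: mat_diag_def)
    have "(?V\<^sup>T * (C * ?W)) $$ (m, k) = (\<Sum>i<n. r m ^ i * (C * ?W) $$ (i, k))"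
      using m k by (auto simp: C_def rev_vandermonde_mat_def vandermonde_mat_def scalar_prod_def
          atLeast0LessThan intro!: sum.cong)
    also have "\<dots> = (\<Sum>i<n. \<Sum>j<n. coeff p (Suc (i + j)) * r m ^ i * r k ^ j)"
      using k by (simp add: CW sum_distrib_left mult_ac)
    also have "\<dots> = (if m = k then poly (pderiv p) (r m) else 0)"
    proof (cases "m = k")
      case True
      thus ?thesis using bezout_sum_diagonal[OF n, of "r m"] by simp
    next
      case False
      hence "r m - r k \<noteq> 0" using inj m k by (auto dest: inj_onD)
      thus ?thesis using bezout_sum_diff[OF n, of "r m" "r k"] False m k
        by (simp add: roots)
    qed
    finally show "(?V\<^sup>T * (C * ?W)) $$ (m, k) = mat_diag n (\<lambda>i. poly (pderiv p) (r i)) $$ (m, k)"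
      using m k by (simp add: mat_diag_def)
  qed (auto simp: mat_diag_def vandermonde_mat_def rev_vandermonde_mat_def)
  hence "det (mat_diag n (\<lambda>i. poly (pderiv p) (r i))) = det (?V\<^sup>T * (C * ?W))" by simp
  also have "\<dots> = det ?V\<^sup>T * det (C * ?W)"
    by (rule det_mult[of _ n]) (auto simp: C_def intro!: mult_carrier_mat[of _ n n])
  also have "det (C * ?W) = det C * det ?W"
    by (rule det_mult[of _ n]) (auto simp: C_def)
  also have "det ?V\<^sup>T = det ?V"
    by (rule det_transpose[of _ n]) simp
  also have "det C = lead_coeff p ^ n"
  proof -
    have "upper_triangular C"
      using n by (intro upper_triangularI) (auto simp: C_def coeff_eq_0)
    hence "det C = prod_list (diag_mat C)"
      by (rule det_upper_triangular[of _ n]) (simp add: C_def)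
    thus ?thesis unfolding prod_list_diag_prod using n by (simp add: C_def)
  qed
  also have "det (mat_diag n (\<lambda>i. poly (pderiv p) (r i))) = (\<Prod>i<n. poly (pderiv p) (r i))"
    by (subst det_upper_triangular[of _ n])
      (auto simp: mat_diag_def prod_list_diag_prod atLeast0LessThan intro!: upper_triangularI)
  finally show ?thesis
    by (simp add: det_rev_vandermonde_mat power2_eq_square mult_ac)
qed

lemma inj_on_if_det_vandermonde_nonzero:
  assumes "det (vandermonde_mat n r) \<noteq> 0"
  shows "inj_on r {..<n}"
proof (rule inj_onI)
  fix i j assume "i \<in> {..<n}" "j \<in> {..<n}" "r i = r j"
  thus "i = j"
    using det_identical_columns[of "vandermonde_mat n r" n i j] assms
    by (force simp: vandermonde_mat_def intro!: eq_vecI)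
qed

subsection \<open>Determinants of explicit matrices\<close>

text \<open>First-row expansion on lists turns a determinant with explicit entries into a polynomial
  by rewriting.\<close>

fun laplace_det :: "'a :: comm_ring_1 list list \<Rightarrow> 'a" where
  "laplace_det [] = 1"
| "laplace_det (r # rs) = (\<Sum>j<length r. (-1) ^ j * (r ! j)
     * laplace_det (map (\<lambda>s. take j s @ drop (Suc j) s) rs))"

declare laplace_det.simps [simp del]

lemma det_mat_eq_laplace_det:
  fixes M :: "'a :: comm_ring_1 list list"
  assumes "length M = n" "\<And>r. r \<in> set M \<Longrightarrow> length r = n"
  shows "det (mat n n (\<lambda>(i, j). M ! i ! j)) = laplace_det M"
  using assms
proof (induction n arbitrary: M)
  case 0
  thus ?case by (simp add: laplace_det.simps)
next
  case (Suc k)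
  define n where "n = Suc k"
  obtain r rs where M: "M = r # rs" using Suc.prems by (cases M) auto
  let ?A = "mat n n (\<lambda>(i, j). (r # rs) ! i ! j)"
  have len: "length r = n" "length rs = k" "\<And>s. s \<in> set rs \<Longrightarrow> length s = n"
    using Suc.prems by (auto simp: n_def M)
  have minor: "det (mat_delete ?A 0 j) = laplace_det (map (\<lambda>s. take j s @ drop (Suc j) s) rs)"
    if j: "j < n" for j
  proof -
    have "mat_delete ?A 0 j
        = mat k k (\<lambda>(i, l). map (\<lambda>s. take j s @ drop (Suc j) s) rs ! i ! l)"
      using j len by (intro eq_matI) (auto simp: n_def mat_delete_def nth_append)
    also have "det \<dots> = laplace_det (map (\<lambda>s. take j s @ drop (Suc j) s) rs)"
      using j len by (intro Suc.IH) (auto simp: n_def)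
    finally show ?thesis .
  qed
  have "det ?A = (\<Sum>j<n. ?A $$ (0, j) * cofactor ?A 0 j)"
    by (rule laplace_expansion_row[of _ n]) (auto simp: n_def)
  also have "\<dots> = laplace_det (r # rs)"
    unfolding laplace_det.simps len(1)
  proof (intro sum.cong refl)
    fix j assume "j \<in> {..<n}"
    hence j: "j < n" by simp
    have 1: "?A $$ (0, j) = r ! j" using j by (simp add: n_def)
    have 2: "cofactor ?A 0 j = (-1) ^ j * laplace_det (map (\<lambda>s. take j s @ drop (Suc j) s) rs)"
      unfolding cofactor_def minor[OF j] by simp
    show "?A $$ (0, j) * cofactor ?A 0 j
        = (-1) ^ j * (r ! j) * laplace_det (map (\<lambda>s. take j s @ drop (Suc j) s) rs)"
      unfolding 1 2 by (simp only: mult_ac)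
  qed
  finally show ?case by (simp add: M n_def)
qed

lemma laplace_det_2:
  "laplace_det [[a0, a1], [b0, b1]] = a0*b1 - a1*b0"
  by (simp add: laplace_det.simps lessThan_Suc)

lemma laplace_det_3:
  "laplace_det [[a0, a1, a2], [b0, b1, b2], [c0, c1, c2]]
    = a0*(b1*c2 - b2*c1) - a1*(b0*c2 - b2*c0) + a2*(b0*c1 - b1*c0)"
  by (subst laplace_det.simps(2)) (simp add: lessThan_Suc laplace_det_2 algebra_simps)

lemma laplace_det_4:
  "laplace_det [[a0, a1, a2, a3], [b0, b1, b2, b3], [c0, c1, c2, c3], [d0, d1, d2, d3]]
    = a0 * laplace_det [[b1, b2, b3], [c1, c2, c3], [d1, d2, d3]]
    - a1 * laplace_det [[b0, b2, b3], [c0, c2, c3], [d0, d2, d3]]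
    + a2 * laplace_det [[b0, b1, b3], [c0, c1, c3], [d0, d1, d3]]
    - a3 * laplace_det [[b0, b1, b2], [c0, c1, c2], [d0, d1, d2]]"
  by (subst laplace_det.simps(2)) (simp add: lessThan_Suc)

subsection \<open>The parametrization of the sextic\<close>

text \<open>Row \<open>i\<close> holds the coefficients of \<open>1, t, \<dots>, t^5\<close> in \<open>t^3 \<kappa>^i\<close> modulo \<open>h\<close>.\<close>

definition krylov_rows :: "'a :: comm_ring_1 \<Rightarrow> 'a \<Rightarrow> 'a list list" where
  "krylov_rows X Y =
    [[0, 0, 0, 1, 0, 0],
     [X, 0, 0, Y, 3*Y, 0],
     [X*(-1 - 10*X + Y), X*(3 - 15*X + 6*Y), X*(-6 - 6*X), -10*X*Y + Y^2, Y*(-15*X + 6*Y),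
      Y*(-6*X + 9*Y)],
     [X*(1 + 56*X - Y + 28*X^2 + 34*X*Y - 26*Y^2), X*(-6 + 42*X - 6*Y + 48*X^2 + 42*X*Y -
      72*Y^2), X*(21 + 42*X + 21*Y + 21*X^2 + 15*X*Y - 54*Y^2), 46*X*Y - 27*Y^2 + 28*X^2*Y +
      7*X*Y^2 - 26*Y^3, Y*(57*X + 48*X^2 + 42*X*Y - 72*Y^2), Y*(21*X + 21*X^2 + 15*X*Y -
      54*Y^2)],
     [X*(-1 - 165*X + Y - 462*X^2 - 140*X*Y - Y^2 - 55*X^3 - 168*X^2*Y - 48*X*Y^2 + 136*Y^3),
      X*(9 + 6*Y - 594*X^2 - 9*Y^2 - 99*X^3 - 276*X^2*Y - 15*X*Y^2 + 336*Y^3), X*(-45 - 297*X -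
      51*Y - 297*X^2 - 168*X*Y - 24*Y^2 - 45*X^3 - 117*X^2*Y + 216*Y^3), -109*X*Y - 434*X^2*Y -
      88*X*Y^2 + 135*Y^3 - 55*X^3*Y - 168*X^2*Y^2 - 48*X*Y^3 + 136*Y^4, Y*(-126*X - 630*X^2 -
      90*X*Y - 81*Y^2 - 99*X^3 - 276*X^2*Y - 96*X*Y^2 + 336*Y^3), Y*(-45*X - 252*X^2 - 30*X*Y -
      45*X^3 - 117*X^2*Y + 216*Y^3)],
     [X*(1 + 364*X - Y + 3003*X^2 + 345*X*Y + Y^2 + 2002*X^3 + 2394*X^2*Y + 78*X*Y^2 - Y^3 +
      91*X^4 + 455*X^3*Y + 573*X^2*Y^2 - 40*X*Y^3 - 512*Y^4), X*(-12 - 273*X - 6*Y + 2574*X^2 -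
      450*X*Y + 9*Y^2 + 3003*X^3 + 2628*X^2*Y - 354*X*Y^2 - 12*Y^3 + 168*X^4 + 804*X^3*Y +
      873*X^2*Y^2 - 240*X*Y^3 - 1200*Y^4), X*(78 + 1365*X + 90*Y + 2574*X^2 + 1431*X*Y + 21*Y^2
      + 1365*X^3 + 1539*X^2*Y + 486*X*Y^2 - 51*Y^3 + 78*X^4 + 360*X^3*Y + 351*X^2*Y^2 - 69*X*Y^3
      - 720*Y^4), 199*X*Y + 2541*X^2*Y + 142*X*Y^2 + 1947*X^3*Y + 2163*X^2*Y^2 - 42*X*Y^3 -
      513*Y^4 + 91*X^4*Y + 455*X^3*Y^2 + 573*X^2*Y^3 - 40*X*Y^4 - 512*Y^5, Y*(222*X + 3366*X^2 +
      138*X*Y + 3069*X^3 + 2940*X^2*Y - 69*X*Y^2 + 324*Y^3 + 168*X^4 + 804*X^3*Y + 873*X^2*Y^2 -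
      240*X*Y^3 - 1200*Y^4), Y*(78*X + 1287*X^2 + 45*X*Y + 1287*X^3 + 1134*X^2*Y - 27*X*Y^2 -
      243*Y^3 + 78*X^4 + 360*X^3*Y + 351*X^2*Y^2 - 312*X*Y^3 - 720*Y^4)]]"

text \<open>The minimal polynomial of \<open>\<kappa>\<close>: this is \<open>3^18 P4\<close> in the variable \<open>\<kappa>\<close>, constant term first and
  without its leading coefficient \<open>1\<close>.\<close>

definition reduced_coeffs :: "'a :: comm_ring_1 \<Rightarrow> 'a \<Rightarrow> 'a list" where
  "reduced_coeffs X Y =
    [27*Y^2 + 108*X*Y^2 + 8*Y^3 + 162*X^2*Y^2 + 1458*X*Y^3 + 108*X^3*Y^2 - 2484*X^2*Y^3 +
      1161*X*Y^4 + 27*X^4*Y^2 + 162*X^3*Y^3 + 324*X^2*Y^4 + 216*X*Y^5,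
     93*Y^2 - 501*X*Y^2 + 24*Y^3 - 513*X^2*Y^2 + 432*X*Y^3 + 81*X^3*Y^2 + 324*X^2*Y^3 +
      324*X*Y^4,
     6*Y + 12*X*Y + 117*Y^2 + 6*X^2*Y + 132*X*Y^2 + 24*Y^3 + 81*X^2*Y^2 + 162*X*Y^3,
     1 + 3*X + 18*Y + 3*X^2 - 84*X*Y + 63*Y^2 + X^3 + 6*X^2*Y + 39*X*Y^2 + 8*Y^3,
     3 - 21*X + 18*Y + 3*X^2 + 12*X*Y + 12*Y^2,
     3 + 3*X + 6*Y]"

definition reduced_poly :: "'a :: comm_ring_1 \<Rightarrow> 'a \<Rightarrow> 'a poly" where
  "reduced_poly X Y = Poly (reduced_coeffs X Y @ [1])"

lemma laplace_det_sparse_row_6: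
  "laplace_det ([0, 0, 0, 1, 0, 0] # rs) = - laplace_det (map (\<lambda>s. take 3 s @ drop 4 s) rs)"
  by (simp add: laplace_det.simps(2) lessThan_Suc numeral_eq_Suc)

lemma laplace_det_sparse_row_5:
  "laplace_det ([a, 0, 0, c, 0] # rs)
    = a * laplace_det (map (\<lambda>s. drop 1 s) rs) - c * laplace_det (map (\<lambda>s. take 3 s @ drop 4 s) rs)"
  by (simp add: laplace_det.simps(2) lessThan_Suc numeral_eq_Suc)

text \<open>The first two rows have one and three possibly nonzero entries. Expanding along them
  leaves just two 4 x 4 minors, which keeps the later ring identity manageable.\<close>

lemma laplace_det_krylov_shape:
  "laplace_det
    [[0, 0, 0, 1, 0, 0], [x, 0, 0, e, y, 0],
     [a0, a1, a2, a3, a4, a5],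
     [b0, b1, b2, b3, b4, b5],
     [c0, c1, c2, c3, c4, c5],
     [d0, d1, d2, d3, d4, d5]]
    = y * laplace_det
    [[a0, a1, a2, a5],
     [b0, b1, b2, b5],
     [c0, c1, c2, c5],
     [d0, d1, d2, d5]]
    - x * laplace_det
    [[a1, a2, a4, a5],
     [b1, b2, b4, b5],
     [c1, c2, c4, c5],
     [d1, d2, d4, d5]]"
  unfolding laplace_det_sparse_row_6 by (simp add: laplace_det_sparse_row_5)

text \<open>The last two factors are \<open>cal_A4 X Y\<close> and \<open>cal_B4 X H\<close>, the
  latter rewritten through \<open>Y = 9*H\<close> so that only \<open>X\<close> and \<open>Y\<close>
  occur.\<close>

lemma laplace_det_krylov_rows:
  fixes X Y :: "'a :: idom"
  shows "laplace_det (krylov_rows X Y) =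
    729 * X^3 * Y^3 * (((X + Y - 1)^2 - 4*(X*Y - X - Y))^2 + 128*(X + Y - 1)*(X*Y)) *
    ((X - 1)*(X + 1)^4 + 2*Y*(11*X^4 - 260*X^3 + 482*X^2 - 260*X + 11)
      + Y^2*(145*X^3 + 1809*X^2 - 1809*X - 145) + 8*Y^3*(19*X^2 - 387*X + 19)
      + 832*Y^4*(1 - X) + 512*Y^5)"
  \<comment> \<open>qualified, because the method \<open>algebra\<close> of \<open>HOL-Algebra\<close> hides this one\<close>
  unfolding krylov_rows_def laplace_det_krylov_shape laplace_det_4 laplace_det_3
  by Groebner_Basis.algebra

lemma sum_six_nth:
  fixes t :: "'a :: comm_ring_1"
  shows "(\<Sum>j<6. [a0, a1, a2, a3, a4, a5] ! j * t ^ j)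
    = a0 + a1*t + a2*t^2 + a3*t^3 + a4*t^4 + a5*t^(5::nat)"
  by (simp add: numeral_eq_Suc lessThan_Suc algebra_simps)

text \<open>Denominator-free form of the parametrization: \<open>m\<close> is
  \<open>t^3 * \<kappa>\<close>, \<open>h\<close> is the polynomial of the fibre, and
  \<open>R i\<close> represents \<open>t^3 * \<kappa>^i\<close> modulo \<open>h\<close>.\<close>

context
  fixes X Y t :: "'a :: idom" and m h :: 'a and R :: "nat \<Rightarrow> 'a"
  defines "m \<equiv> X + Y*t^3 + 3*Y*t^4"
    and "h \<equiv> X*(1 + t)^3 + Y*t^3*(1 + t)^3 + t^3"
    and "R \<equiv> \<lambda>i. \<Sum>j<6. krylov_rows X Y ! i ! j * t ^ j"
begin

lemma krylov_row_0: "R 0 = t^3"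
  unfolding R_def krylov_rows_def nth_Cons_Suc nth_Cons_0 sum_six_nth by simp

text \<open>Multiplication by \<open>\<kappa>\<close> modulo \<open>h\<close>, with the quotients by
  \<open>h\<close> written out so that each congruence becomes a polynomial identity.\<close>

lemma krylov_step:
  "m * R 0 = t^3 * R (Suc 0)
    + (0) * h"
  "m * R (Suc 0) = t^3 * R (Suc (Suc 0))
    + ((X) + (-3*X)*t + (6*X)*t^2) * h"
  "m * R (Suc (Suc 0)) = t^3 * R (Suc (Suc (Suc 0)))
    + ((-X - 10*X^2 + X*Y) + (6*X + 15*X^2 + 3*X*Y)*t + (-21*X - 21*X^2 - 12*X*Y)*t^2 + (-18*X*Y
      + 27*Y^2)*t^3) * h"
  "m * R (Suc (Suc (Suc 0))) = t^3 * R (Suc (Suc (Suc (Suc 0))))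
    + ((X + 56*X^2 - X*Y + 28*X^3 + 34*X^2*Y - 26*X*Y^2) + (-9*X - 126*X^2 - 3*X*Y - 36*X^3 -
      60*X^2*Y + 6*X*Y^2)*t + (45*X + 252*X^2 + 33*X*Y + 45*X^3 + 93*X^2*Y + 6*X*Y^2)*t^2 +
      (63*X*Y + 63*X^2*Y + 45*X*Y^2 - 162*Y^3)*t^3) * h"
  "m * R (Suc (Suc (Suc (Suc 0)))) = t^3 * R (Suc (Suc (Suc (Suc (Suc 0)))))
    + ((-X - 165*X^2 + X*Y - 462*X^3 - 140*X^2*Y - X*Y^2 - 55*X^4 - 168*X^3*Y - 48*X^2*Y^2 +
      136*X*Y^3) + (12*X + 495*X^2 + 3*X*Y + 792*X^3 + 420*X^2*Y - 6*X*Y^2 + 66*X^4 + 228*X^3*Y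
      + 129*X^2*Y^2 - 72*X*Y^3)*t + (-78*X - 1287*X^2 - 63*X*Y - 1287*X^3 - 1008*X^2*Y - 3*X*Y^2
      - 78*X^4 - 297*X^3*Y - 243*X^2*Y^2 + 24*X*Y^3)*t^2 + (-135*X*Y - 756*X^2*Y - 90*X*Y^2 -
      135*X^3*Y - 351*X^2*Y^2 + 648*Y^4)*t^3) * h"
  unfolding m_def h_def R_def krylov_rows_def nth_Cons_Suc nth_Cons_0 sum_six_nth
  by Groebner_Basis.algebra+

text \<open>The sixth power closes the chain: \<open>m * R 5\<close> stands for
  \<open>t^6 * \<kappa>^6\<close>, and the left side is \<open>t^6\<close> times the monic sextic in
  \<open>\<kappa>\<close>, hence a multiple of \<open>h\<close>.\<close>

lemma krylov_relation:
  "m * R (Suc (Suc (Suc (Suc (Suc 0))))) + t^3 * (reduced_coeffs X Y ! 0 * R 0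
    + reduced_coeffs X Y ! (Suc 0) * R (Suc 0)
    + reduced_coeffs X Y ! (Suc (Suc 0)) * R (Suc (Suc 0))
    + reduced_coeffs X Y ! (Suc (Suc (Suc 0))) * R (Suc (Suc (Suc 0)))
    + reduced_coeffs X Y ! (Suc (Suc (Suc (Suc 0)))) * R (Suc (Suc (Suc (Suc 0))))
    + reduced_coeffs X Y ! (Suc (Suc (Suc (Suc (Suc 0))))) * R (Suc (Suc (Suc (Suc (Suc 0))))))
    = ((X + 364*X^2 - X*Y + 3003*X^3 + 345*X^2*Y + X*Y^2 + 2002*X^4 + 2394*X^3*Y + 78*X^2*Y^2 -
      X*Y^3 + 91*X^5 + 455*X^4*Y + 573*X^3*Y^2 - 40*X^2*Y^3 - 512*X*Y^4) + (-15*X - 1365*X^2 -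
      3*X*Y - 6435*X^3 - 1485*X^2*Y + 6*X*Y^2 - 3003*X^4 - 4554*X^3*Y - 588*X^2*Y^2 - 9*X*Y^3 -
      105*X^5 - 561*X^4*Y - 846*X^3*Y^2 - 120*X^2*Y^3 + 336*X*Y^4)*t + (120*X + 4368*X^2 +
      102*X*Y + 12870*X^3 + 4851*X^2*Y + 4368*X^4 + 8019*X^3*Y + 2016*X^2*Y^2 - 21*X*Y^3 +
      120*X^5 + 678*X^4*Y + 1170*X^3*Y^2 + 411*X^2*Y^3 - 192*X*Y^4)*t^2 + (234*X*Y + 3861*X^2*Y
      + 135*X*Y^2 + 3861*X^3*Y + 3402*X^2*Y^2 - 81*X*Y^3 - 729*Y^4 + 234*X^4*Y + 1080*X^3*Y^2 +
      1053*X^2*Y^3 - 936*X*Y^4 - 2160*Y^5)*t^3) * h"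
  unfolding m_def h_def R_def krylov_rows_def reduced_coeffs_def nth_Cons_Suc nth_Cons_0 sum_six_nth
  by Groebner_Basis.algebra

text \<open>On \<open>h = 0\<close> the quotient terms drop out, and each step to the next power
  cancels one factor \<open>t^3\<close>.\<close>

lemma krylov_powers:
  assumes h: "h = 0" and t: "t \<noteq> 0" and k: "k * t^3 = m" and i: "i < 6"
  shows "t^3 * k^i = R i"
proof -
  have step: "t^3 * k^Suc n = R (Suc n)" if "t^3 * k^n = R n" "m * R n = t^3 * R (Suc n)" for n
  proof -
    have "t^3 * (t^3 * k^Suc n) = (k * t^3) * (t^3 * k^n)" by (simp add: mult_ac)
    also have "\<dots> = t^3 * R (Suc n)" unfolding k that by (rule refl)
    finally show ?thesis using t by (metis mult_left_cancel power_not_zero)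
  qed
  note steps = krylov_step[unfolded h mult_zero_right add_0_right]
  have 0: "t^3 * k^0 = R 0" by (simp add: krylov_row_0)
  note 1 = step[OF 0 steps(1)]
  note 2 = step[OF 1 steps(2)]
  note 3 = step[OF 2 steps(3)]
  note 4 = step[OF 3 steps(4)]
  note 5 = step[OF 4 steps(5)]
  from i have "i \<in> {0, Suc 0, Suc (Suc 0), Suc (Suc (Suc 0)), Suc (Suc (Suc (Suc 0))),
    Suc (Suc (Suc (Suc (Suc 0))))}"
    by auto
  thus ?thesis using 0 1 2 3 4 5 by blast
qed

lemma reduced_poly_root:
  assumes h: "h = 0" and t: "t \<noteq> 0" and k: "k * t^3 = m"
  shows "poly (reduced_poly X Y) k = 0"
proof -
  note pow = krylov_powers[OF h t k]
  \<comment> \<open>The second \<open>t^3\<close> splits the leading term as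
    \<open>(k * t^3) * (t^3 * k^5)\<close>, the shape of \<open>krylov_relation\<close>.\<close>
  have "t^3 * (t^3 * poly (reduced_poly X Y) k)
      = (k * t^3) * (t^3 * k^5) + t^3 * (\<Sum>i<6. reduced_coeffs X Y ! i * (t^3 * k^i))"
    unfolding reduced_poly_def reduced_coeffs_def
    by (simp add: numeral_eq_Suc lessThan_Suc algebra_simps)
  also have "(\<Sum>i<6. reduced_coeffs X Y ! i * (t^3 * k^i)) = (\<Sum>i<6. reduced_coeffs X Y ! i * R i)"
    by (intro sum.cong) (simp_all add: pow)
  also have "(k * t^3) * (t^3 * k^5) + t^3 * (\<Sum>i<6. reduced_coeffs X Y ! i * R i) = 0"
    unfolding k pow[of 5, simplified] using krylov_relation[unfolded h]
    by (simp add: numeral_eq_Suc lessThan_Suc add_ac)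
  finally show ?thesis using t by simp
qed

end

subsection \<open>The discriminant of the fibre polynomial\<close>

definition fibre_poly :: "'a :: idom \<Rightarrow> 'a \<Rightarrow> 'a poly" where
  "fibre_poly X Y = [:X, 3*X, 3*X, X + Y + 1, 3*Y, 3*Y, Y:]"

lemma poly_fibre_poly: "poly (fibre_poly X Y) t = X*(1 + t)^3 + Y*t^3*(1 + t)^3 + t^3"
  unfolding fibre_poly_def poly_pCons poly_0 by Groebner_Basis.algebra

text \<open>Subtracting three times the polynomial removes the summand \<open>t^3\<close> and
  exposes the common factor \<open>(1 + t)^2\<close>. At a root, the derivative is thus a product of
  simple expressions.\<close>

lemma poly_pderiv_fibre_poly:
  "t * poly (pderiv (fibre_poly X Y)) t
    = 3 * poly (fibre_poly X Y) t + 3 * (1 + t)^2 * (Y*t^4 - X)"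
  unfolding fibre_poly_def pderiv_pCons pderiv_0 poly_add poly_pCons poly_0
  by Groebner_Basis.algebra

text \<open>With this \<open>X\<close> the first two terms combine, because
  \<open>z^4 + z^3 = z^3 * (1 + z)\<close>.\<close>

lemma fibre_poly_at_cusp:
  assumes "X = Y*z^4"
  shows "poly (fibre_poly X Y) z = z^3 * (Y*(1 + z)^4 + 1)"
  unfolding poly_fibre_poly assms by Groebner_Basis.algebra

lemma cal_A4_eq:
  "cal_A4 X Y = ((X + Y - 1)^2 - 4*(X*Y - X - Y))^2 + 128*(X + Y - 1)*(X*Y)"
  by (simp add: cal_A4_def)

text \<open>\<open>cal_A4\<close> is the norm of \<open>Y*(1 + \<rho>)^4 + 1\<close> under
  \<open>\<rho> \<mapsto> \<iota>*\<rho>\<close>. Opposite conjugates are multiplied first; a pair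
  then enters only through \<open>a*b\<close> and \<open>a^2 + b^2\<close>.\<close>

lemma cal_A4_eq_norm:
  fixes \<rho> \<iota> Y :: "'a :: idom"
  assumes \<iota>: "\<iota>^2 = -1"
  shows "(Y*(1 + \<rho>)^4 + 1) * (Y*(1 + (-\<rho>))^4 + 1)
    * ((Y*(1 + \<iota>*\<rho>)^4 + 1) * (Y*(1 + (-\<iota>*\<rho>))^4 + 1)) = cal_A4 (Y*\<rho>^4) Y"
proof -
  have pair: "(Y*a^4 + 1) * (Y*b^4 + 1) = Y^2*(a*b)^4 + Y*((a^2 + b^2)^2 - 2*(a*b)^2) + 1"
    for a b :: 'a by Groebner_Basis.algebra
  have real: "(1 + \<rho>) * (1 + (-\<rho>)) = 1 - \<rho>^2" "(1 + \<rho>)^2 + (1 + (-\<rho>))^2 = 2 + 2*\<rho>^2"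
    by Groebner_Basis.algebra+
  have imag: "(1 + \<iota>*\<rho>) * (1 + (-\<iota>*\<rho>)) = 1 - \<iota>^2*\<rho>^2"
    "(1 + \<iota>*\<rho>)^2 + (1 + (-\<iota>*\<rho>))^2 = 2 + 2*(\<iota>^2*\<rho>^2)"
    by Groebner_Basis.algebra+
  show ?thesis
    unfolding pair real imag \<iota> cal_A4_eq by Groebner_Basis.algebra
qed

text \<open>Each product over the roots is read off from values of the polynomial at 0, at -1 and at
  the solutions of \<open>Y*z^4 = X\<close>. Distinctness comes last: a double root would make the
  nonzero product of derivatives vanish.\<close>

lemma fibre_roots:
  fixes X Y :: complex
  assumes X: "X \<noteq> 0" and Y: "Y \<noteq> 0" and A: "cal_A4 X Y \<noteq> 0"
  obtains t :: "nat \<Rightarrow> complex" where "\<And>i. i < 6 \<Longrightarrow> poly (fibre_poly X Y) (t i) = 0" "\<And>i. i < 6 \<Longrightarrow> t i \<noteq> 0"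
    "inj_on t {..<6}" "(\<Prod>i<6. t i) = X / Y"
    "(\<Prod>i<6. poly (pderiv (fibre_poly X Y)) (t i)) = - (729 * X^2 / Y^2 * cal_A4 X Y)"
proof -
  let ?h = "fibre_poly X Y"
  have deg: "degree ?h = 6" and lc: "lead_coeff ?h = Y"
    using Y by (simp_all add: fibre_poly_def)
  obtain t :: "nat \<Rightarrow> complex" where t: "?h = smult Y (\<Prod>i<6. [:- t i, 1:])"
    using complex_poly_decompose'[of ?h] deg lc by metis
  have h_eq: "poly ?h z = Y * (\<Prod>i<6. z - t i)" for z
    by (subst t) (simp add: poly_prod)
  have root: "poly ?h (t i) = 0" if "i < 6" for i
    using that by (auto simp: h_eq intro!: prod_zero)
  have h0: "poly ?h 0 = X" and h1: "poly ?h (-1) = -1"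
    by (simp_all add: poly_fibre_poly)
  have t0: "t i \<noteq> 0" if "i < 6" for i
    using root[OF that] X h0 by auto
  \<comment> \<open>The number of factors is even, so reversing all differences does not change the
    sign.\<close>
  have even: "(\<Prod>i<6. t i - z) = (\<Prod>i<6. z - t i)" for z
  proof -
    have "(\<Prod>i<6. t i - z) = (\<Prod>i<6. (-1) * (z - t i))" by simp
    also have "\<dots> = (\<Prod>i<6. z - t i)" unfolding prod.distrib by simp
    finally show ?thesis .
  qed
  have prod_t: "(\<Prod>i<6. t i) = X / Y"
    using h_eq[of 0] even[of 0] h0 Y by (simp add: field_simps)
  have prod_1t: "(\<Prod>i<6. 1 + t i) = - 1 / Y"
    using h_eq[of "-1"] even[of "-1"] h1 Y by (simp add: field_simps)
  \<comment> \<open>A fourth root of \<open>X / Y\<close>; the solutions of \<open>Y*z^4 = X\<close>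
    are then \<open>\<rho>\<close>, \<open>-\<rho>\<close>, \<open>\<i>*\<rho>\<close> and
    \<open>-\<i>*\<rho>\<close>.\<close>
  define \<rho> where "\<rho> = csqrt (csqrt (X / Y))"
  have \<rho>: "\<rho>^4 = X / Y"
  proof -
    have "\<rho>^4 = (\<rho>^2)^2" by simp
    thus ?thesis unfolding \<rho>_def power2_csqrt .
  qed
  hence X_eq: "X = Y*\<rho>^4" using Y by simp
  have split: "Y*z^4 - X = Y * ((z - \<rho>) * (z - (-\<rho>)) * ((z - \<i>*\<rho>) * (z - (-\<i>*\<rho>))))" for z
  proof -
    have "(z - \<rho>) * (z - (-\<rho>)) = z^2 - \<rho>^2" "(z - \<i>*\<rho>) * (z - (-\<i>*\<rho>)) = z^2 + \<rho>^2"
      by (simp_all add: algebra_simps power2_eq_square)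
    hence "(z - \<rho>) * (z - (-\<rho>)) * ((z - \<i>*\<rho>) * (z - (-\<i>*\<rho>))) = z^4 - \<rho>^4"
      by (simp add: algebra_simps power2_eq_square power4_eq_xxxx)
    thus ?thesis unfolding X_eq by (simp only: right_diff_distrib)
  qed
  \<comment> \<open>The double product over both root sets is regrouped. The left side carries
    \<open>Y^6\<close> and the four values carry \<open>Y^4\<close>, which leaves
    \<open>Y^2\<close>.\<close>
  have "(\<Prod>i<6. Y * t i^4 - X)
      = Y^2 * (poly ?h \<rho> * poly ?h (-\<rho>) * (poly ?h (\<i>*\<rho>) * poly ?h (-\<i>*\<rho>)))"
    unfolding split prod.distrib even h_eq by (simp add: power2_eq_square) (simp add: eval_nat_numeral)
  also have "poly ?h \<rho> * poly ?h (-\<rho>) * (poly ?h (\<i>*\<rho>) * poly ?h (-\<i>*\<rho>))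
      = - ((\<rho>^4)^3 * cal_A4 X Y)"
  proof -
    have z: "poly ?h z = z^3 * (Y*(1 + z)^4 + 1)" if "z^4 = \<rho>^4" for z
      using fibre_poly_at_cusp[of X Y z] that X_eq by simp
    have i4: "(\<i>*\<rho>)^4 = \<rho>^4" "(-\<i>*\<rho>)^4 = \<rho>^4" by (simp_all add: power_mult_distrib)
    have "poly ?h \<rho> * poly ?h (-\<rho>) * (poly ?h (\<i>*\<rho>) * poly ?h (-\<i>*\<rho>))
      = (\<rho> * (-\<rho>) * (\<i>*\<rho>) * (-\<i>*\<rho>))^3
        * ((Y*(1 + \<rho>)^4 + 1) * (Y*(1 + (-\<rho>))^4 + 1)
          * ((Y*(1 + \<i>*\<rho>)^4 + 1) * (Y*(1 + (-\<i>*\<rho>))^4 + 1)))"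
      using z[of \<rho>] z[of "-\<rho>"] z[OF i4(1)] z[OF i4(2)] by (simp only: power_mult_distrib mult_ac) simp
    \<comment> \<open>The minus sign of the final product comes from here: four conjugates multiply
      to \<open>-(\<rho>^4)\<close>.\<close>
    also have "\<rho> * (-\<rho>) * (\<i>*\<rho>) * (-\<i>*\<rho>) = (\<i>*\<i>) * \<rho>^4"
      by (simp only: power4_eq_xxxx mult_minus_left mult_minus_right minus_minus mult_ac)
    also have "\<dots> = - (\<rho>^4)" by simp
    finally show ?thesis unfolding cal_A4_eq_norm[OF power2_i] X_eq[symmetric] by simp
  qed
  finally have prod_cusp: "(\<Prod>i<6. Y * t i^4 - X) = - (Y^2 * (X/Y)^3 * cal_A4 X Y)"
    by (simp add: \<rho>)
  have "(\<Prod>i<6. t i) * (\<Prod>i<6. poly (pderiv ?h) (t i)) = (\<Prod>i<6. t i * poly (pderiv ?h) (t i))"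
    by (rule prod.distrib[symmetric])
  also have "\<dots> = (\<Prod>i<6. 3 * (1 + t i)^2 * (Y * t i^4 - X))"
    by (intro prod.cong refl) (simp add: poly_pderiv_fibre_poly root)
  also have "\<dots> = 729 * (\<Prod>i<6. 1 + t i)^2 * (\<Prod>i<6. Y * t i^4 - X)"
    unfolding prod.distrib prod_power_distrib by simp
  finally have "X / Y * (\<Prod>i<6. poly (pderiv ?h) (t i))
      = 729 * (- 1 / Y)^2 * - (Y^2 * (X/Y)^3 * cal_A4 X Y)"
    unfolding prod_t prod_1t prod_cusp .
  hence "(\<Prod>i<6. poly (pderiv ?h) (t i))
      = Y / X * (729 * (- 1 / Y)^2 * - (Y^2 * (X/Y)^3 * cal_A4 X Y))"
    using X Y by (simp add: field_simps)
  also have "\<dots> = - (729 * X^2 / Y^2 * cal_A4 X Y)"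
    using X Y by (simp add: field_simps power2_eq_square power3_eq_cube)
  finally have prod_deriv:
    "(\<Prod>i<6. poly (pderiv ?h) (t i)) = - (729 * X^2 / Y^2 * cal_A4 X Y)" .
  have "inj_on t {..<6}"
  proof (rule inj_onI, rule ccontr)
    fix i j :: nat assume ij: "i \<in> {..<6}" "j \<in> {..<6}" "t i = t j" "i \<noteq> j"
    have "[:- t i, 1:] ^ 2 dvd ?h"
    proof -
      have "[:- t i, 1:] ^ 2 = (\<Prod>k\<in>{i, j}. [:- t k, 1:])"
        using ij by (simp add: power2_eq_square)
      also have "\<dots> dvd (\<Prod>k<6. [:- t k, 1:])"
        by (rule prod_dvd_prod_subset) (use ij in auto)
      finally show ?thesis by (subst t) (rule dvd_smult)
    qed
    then obtain q where q: "?h = [:- t i, 1:] ^ 2 * q" by (elim dvdE)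
    define u where "u = [:- t i, 1:]"
    have "poly u (t i) = 0" by (simp add: u_def)
    hence "poly (pderiv ?h) (t i) = 0"
      unfolding q u_def[symmetric] power2_eq_square pderiv_mult by simp
    hence "(\<Prod>i<6. poly (pderiv ?h) (t i)) = 0" using ij by (intro prod_zero) auto
    thus False using prod_deriv X Y A by simp
  qed
  thus ?thesis using that root t0 prod_t prod_deriv by blast
qed

subsection \<open>The discriminant of the sextic\<close>

text \<open>Determinants of the change from powers of \<open>t\<close> to powers of
  \<open>\<kappa>\<close> compare the two Vandermonde determinants; their squares give the products
  of derivatives.\<close>

lemma prod_pderiv_reduced_poly:
  fixes X H :: complex
  assumes X: "X \<noteq> 0" and H: "H \<noteq> 0" and A: "cal_A4 X (9*H) \<noteq> 0" and B: "cal_B4 X H \<noteq> 0"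
  obtains \<kappa> :: "nat \<Rightarrow> complex"
  where "\<And>i. i < 6 \<Longrightarrow> poly (reduced_poly X (9*H)) (\<kappa> i) = 0" "inj_on \<kappa> {..<6}"
    "(\<Prod>i<6. poly (pderiv (reduced_poly X (9*H))) (\<kappa> i))
      = - (3^18 * X^2 * (9*H)^4 * cal_A4 X (9*H)^3 * cal_B4 X H^2)"
proof -
  define Y where "Y = 9*H"
  have Y: "Y \<noteq> 0" using H by (simp add: Y_def)
  let ?A = "cal_A4 X Y" and ?B = "cal_B4 X H"
  obtain t :: "nat \<Rightarrow> complex"
    where root: "\<And>i. i < 6 \<Longrightarrow> poly (fibre_poly X Y) (t i) = 0"
      and t0: "\<And>i. i < 6 \<Longrightarrow> t i \<noteq> 0" and inj: "inj_on t {..<6}"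
      and prod_t: "(\<Prod>i<6. t i) = X / Y"
      and prod_deriv: "(\<Prod>i<6. poly (pderiv (fibre_poly X Y)) (t i)) = - (729 * X^2 / Y^2 * ?A)"
    using fibre_roots[OF X Y A[folded Y_def]] by blast
  define \<kappa> where "\<kappa> i = (X + Y*t i^3 + 3*Y*t i^4) / t i^3" for i
  have \<kappa>: "\<kappa> i * t i^3 = X + Y*t i^3 + 3*Y*t i^4" if "i < 6" for i
    using t0[OF that] by (simp add: \<kappa>_def)
  have pow: "\<kappa> j^i * t j^3 = (\<Sum>l<6. krylov_rows X Y ! i ! l * t j^l)" if "i < 6" "j < 6" for i j
    by (subst mult.commute, rule krylov_powers) (use root[unfolded poly_fibre_poly] t0 \<kappa> that in auto)
  have \<kappa>_root: "poly (reduced_poly X Y) (\<kappa> i) = 0" if "i < 6" for i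
    by (rule reduced_poly_root[where t = "t i"]) (use root[unfolded poly_fibre_poly] t0 \<kappa> that in auto)
  let ?V = "vandermonde_mat 6 \<kappa>" and ?W = "vandermonde_mat 6 t"
  define G where "G = mat 6 6 (\<lambda>(i, j). krylov_rows X Y ! i ! j)"
  have "?V * mat_diag 6 (\<lambda>i. t i^3) = G * ?W"
    by (subst mat_diag_mult_right[of _ 6], simp, rule eq_matI)
       (auto simp: vandermonde_mat_def G_def scalar_prod_def atLeast0LessThan pow)
  hence "det (?V * mat_diag 6 (\<lambda>i. t i^3)) = det (G * ?W)" by simp
  hence "det ?V * det (mat_diag 6 (\<lambda>i. t i^3)) = det G * det ?W"
    by (simp add: det_mult[of _ 6] G_def)
  moreover have "det (mat_diag 6 (\<lambda>i. t i^3)) = (X / Y)^3"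
    unfolding prod_t[symmetric] prod_power_distrib
    by (subst det_upper_triangular[of _ 6])
       (auto simp: mat_diag_def prod_list_diag_prod atLeast0LessThan intro!: upper_triangularI)
  moreover have "det G = 729 * X^3 * Y^3 * ?A * ?B"
  proof -
    have "det G = laplace_det (krylov_rows X Y)" unfolding G_def
      by (rule det_mat_eq_laplace_det) (auto simp: krylov_rows_def)
    also have "\<dots> = 729 * X^3 * Y^3 * ?A * ?B"
      unfolding laplace_det_krylov_rows cal_A4_eq[symmetric]
      by (rule arg_cong[where f = "\<lambda>b. 729 * X^3 * Y^3 * ?A * b"]) (simp add: cal_B4_def Y_def power_mult_distrib)
    finally show ?thesis .
  qed
  ultimately have "det ?V * (X / Y)^3 = 729 * X^3 * Y^3 * ?A * ?B * det ?W" by simp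
  hence V: "det ?V = 729 * Y^6 * ?A * ?B * det ?W"
    using X Y by (simp add: field_simps)
  \<comment> \<open>The common sign in \<open>prod_pderiv_roots\<close> for both polynomials; it is
    carried along until \<open>W\<close> absorbs it.\<close>
  define \<epsilon> :: complex where "\<epsilon> = det (exchange_mat 6)"
  have \<epsilon>: "\<epsilon> * \<epsilon> = 1" unfolding \<epsilon>_def by (rule det_exchange_mat_square)
  have "- (729 * X^2 / Y^2 * ?A) = Y^6 * \<epsilon> * det ?W^2"
    using prod_pderiv_roots[of "fibre_poly X Y" 6 t] root inj Y prod_deriv
    by (simp add: fibre_poly_def \<epsilon>_def)
  hence W: "Y^8 * \<epsilon> * det ?W^2 = - (729 * X^2 * ?A)"
    using Y by (simp add: field_simps)
  \<comment> \<open>Here \<open>A\<close> and \<open>B\<close> nonzero make the six values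
    \<open>\<kappa> i\<close> distinct.\<close>
  hence "det ?W \<noteq> 0" using X A by (auto simp: Y_def)
  hence "det ?V \<noteq> 0" using V Y A B by (auto simp: Y_def)
  hence inj_\<kappa>: "inj_on \<kappa> {..<6}" by (rule inj_on_if_det_vandermonde_nonzero)
  have deg: "degree (reduced_poly X Y) = 6" and lc: "lead_coeff (reduced_poly X Y) = 1"
    by (simp_all add: reduced_poly_def reduced_coeffs_def)
  have "(\<Prod>i<6. poly (pderiv (reduced_poly X Y)) (\<kappa> i)) = \<epsilon> * det ?V^2"
    using prod_pderiv_roots[of "reduced_poly X Y" 6 \<kappa>] \<kappa>_root inj_\<kappa> deg lc by (simp add: \<epsilon>_def)
  also have "\<dots> = 729^2 * Y^4 * ?A^2 * ?B^2 * (Y^8 * \<epsilon> * det ?W^2)"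
    unfolding V by (simp add: power_mult_distrib flip: power_add power_mult)
  also have "\<dots> = - (3^18 * X^2 * Y^4 * ?A^3 * ?B^2)"
    unfolding W by (simp add: power2_eq_square power3_eq_cube)
  finally show ?thesis using that \<kappa>_root inj_\<kappa> unfolding Y_def by blast
qed

text \<open>The left side is \<open>3^18 * P4\<close> with denominators cleared. After the shift by
  \<open>(1 + x)^3\<close>, only \<open>x^3\<close> remains, and \<open>27^6 = 3^18\<close> accounts
  for the scaling.\<close>

lemma sextic_eq_reduced:
  fixes x H F :: "'a :: idom"
  shows "3^5 * (- 2 * x^3 * (1 + x)^8 * (x^2 + x + 1) * H + 3 * x^3 * (1 + x)^4 * (4*x^4 + 24*x^3 + 57*x^2 +
      57*x + 33) * H^2 - 6 * x^3 * (4*x^6 + 36*x^5 - 585*x^4 + 324*x^3 - 135*x^2 + 486*x - 486) *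
      H^3 - 729 * x^3 * (36*x^2 + 36*x - 31) * H^4 + 52488 * x^3 * H^5)
    + 3^6 * (1 * x^2 * (1 + x)^9 * (x^2 + x + 1) - 6 * x^2 * (1 + x)^5 * (2*x^4 + 19*x^3 + 29*x^2 + 27*x
      + 9) * H + 9 * x^2 * (1 + x) * (4*x^6 + 68*x^5 + 85*x^4 + 729*x^3 + 588*x^2 + 513*x - 135) *
      H^2 - 324 * x^2 * (2*x^4 - 69*x^3 - 51*x^2 + 45*x + 18) * H^3 - 78732 * x^3 * H^4)*F
    + 3^8 * (1 * x * (1 + x)^6 * (x^4 + 13*x^3 + 15*x^2 + 13*x + 1) - 6 * x * (1 + x)^2 * (x^6 + 25*x^5 +
      138*x^4 + 241*x^3 + 226*x^2 + 99*x + 9) * H + 27 * x * (12*x^5 + 27*x^4 + 243*x^3 + 422*x^2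
      + 171*x - 45) * H^2 + 486 * x * (23*x^2 - 12*x - 12) * H^3)*F^2
    + 3^9 * (1 * (1 + x)^3 * (x^6 + 33*x^5 + 204*x^4 + 263*x^3 + 204*x^2 + 33*x + 1) - 54 * H * (3*x^6 +
      36*x^5 + 126*x^4 + 166*x^3 + 114*x^2 + 24*x + 1) + 243 * (3*x^3 + 48*x^2 + 48*x - 5) * H^2 -
      5832 * H^3)*F^3
    + 3^13 * (1 * (x^6 + 15*x^5 + 60*x^4 + 83*x^3 + 60*x^2 + 15*x + 1) - 18 * (3*x^3 + 15*x^2 + 15*x + 2)
      * H + 324 * H^2)*F^4
    + 3^16 * (1 * (1 + x) * (x^2 + 5*x + 1) - 18*H)*F^5
    + 3^18 * F^6 = poly (reduced_poly (x^3) (9*H)) (- ((1 + x)^3) - 27*F)"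
  unfolding reduced_poly_def reduced_coeffs_def append_Cons append_Nil Poly.simps poly_pCons poly_0
  by Groebner_Basis.algebra

lemma resultant_pderiv_sextic:
  fixes x H :: complex
  assumes x: "x \<noteq> 0" and H: "H \<noteq> 0"
    and A: "cal_A4 (x^3) (9*H) \<noteq> 0" and B: "cal_B4 (x^3) H \<noteq> 0"
    and deg: "degree p = 6" and monic: "monic p"
    and eval: "\<And>F. 3^18 * poly p F = poly (reduced_poly (x^3) (9*H)) (- ((1 + x)^3) - 27*F)"
  shows "resultant p (pderiv p)
    = - (1 / 3^64 * H^4 * x^6 * cal_A4 (x^3) (9*H)^3 * cal_B4 (x^3) H^2)"
proof -
  let ?P = "reduced_poly (x^3) (9*H)"
  define L where "L = [:- ((1 + x)^3), - 27:]"
  have p: "p = smult (1 / 3^18) (pcompose ?P L)"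
  proof (subst poly_eq_poly_eq_iff[symmetric], rule ext)
    fix F
    have L: "poly L F = - ((1 + x)^3) - 27*F" by (simp add: L_def)
    show "poly p F = poly (smult (1 / 3^18) (pcompose ?P L)) F"
      unfolding poly_smult poly_pcompose L eval[symmetric] by simp
  qed
  have "x^3 \<noteq> 0" using x by simp
  then obtain \<kappa> :: "nat \<Rightarrow> complex"
    where root: "\<And>i. i < 6 \<Longrightarrow> poly ?P (\<kappa> i) = 0" and inj: "inj_on \<kappa> {..<6}"
      and prod: "(\<Prod>i<6. poly (pderiv ?P) (\<kappa> i))
        = - (3^18 * (x^3)^2 * (9*H)^4 * cal_A4 (x^3) (9*H)^3 * cal_B4 (x^3) H^2)"
    using prod_pderiv_reduced_poly[OF _ H A B] by blast
  define f where "f i = (- ((1 + x)^3) - \<kappa> i) / 27" for i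
  have f: "poly L (f i) = \<kappa> i" for i by (simp add: L_def f_def field_simps)
  have f_root: "poly p (f i) = 0" if "i < 6" for i
    using root[OF that] by (simp add: p poly_pcompose f)
  have f_inj: "inj_on f {..<6}"
    using inj by (auto simp: inj_on_def f_def)
  have "poly (pderiv p) (f i) = - 27 / 3^18 * poly (pderiv ?P) (\<kappa> i)" for i
    unfolding p by (simp add: pderiv_smult pderiv_pcompose poly_pcompose f) (simp add: L_def pderiv_pCons)
  hence "(\<Prod>i<6. poly (pderiv p) (f i)) = (- 27 / 3^18)^6 * (\<Prod>i<6. poly (pderiv ?P) (\<kappa> i))"
    by (simp only: prod.distrib prod_constant card_lessThan)
  \<comment> \<open>Powers of 3: the chain rule gives \<open>18 - 108\<close>, the product over
    \<open>\<kappa>\<close> gives 18, and \<open>(9*H)^4\<close> gives 8, in total -64.\<close>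
  also have "\<dots> = - (1 / 3^64 * H^4 * x^6 * cal_A4 (x^3) (9*H)^3 * cal_B4 (x^3) H^2)"
    unfolding prod by (simp add: power_mult_distrib power_divide)
  finally have prod_f: "(\<Prod>i<6. poly (pderiv p) (f i))
    = - (1 / 3^64 * H^4 * x^6 * cal_A4 (x^3) (9*H)^3 * cal_B4 (x^3) H^2)" .
  \<comment> \<open>By \<open>prod_pderiv_roots\<close> a nonzero product forces a nonzero
    Vandermonde determinant, as the resultant formula requires.\<close>
  hence "(\<Prod>i<6. poly (pderiv p) (f i)) \<noteq> 0" using x H A B by simp
  hence "det (vandermonde_mat (degree p) f) \<noteq> 0"
    using prod_pderiv_roots[of p 6 f] deg f_root f_inj by auto
  hence "resultant p (pderiv p) = (\<Prod>i<degree p. poly (pderiv p) (f i))"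
    by (intro resultant_eq_prod_roots) (use monic deg f_root in auto)
  thus ?thesis unfolding deg prod_f .
qed

section \<open>Specialization at rational points\<close>

text \<open>The outer variable \<open>H\<close> is replaced first, by a constant polynomial in
  \<open>x\<close>. Values are taken in the complex numbers, where the fibre polynomial
  splits.\<close>

definition eval_xH :: "rat \<Rightarrow> rat \<Rightarrow> rat_poly_xH \<Rightarrow> complex" where
  "eval_xH x H p = of_rat (poly (poly p [:H:]) x)"

lemma eval_xH_hom: "comm_ring_hom (eval_xH x H)"
  by unfold_locales (simp_all add: eval_xH_def of_rat_add of_rat_mult)

lemma eval_xH_simps:
  "eval_xH x H (p + q) = eval_xH x H p + eval_xH x H q"
  "eval_xH x H (p - q) = eval_xH x H p - eval_xH x H q"
  "eval_xH x H (p * q) = eval_xH x H p * eval_xH x H q"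
  "eval_xH x H (- p) = - eval_xH x H p"
  "eval_xH x H (p ^ n) = eval_xH x H p ^ n"
  "eval_xH x H 0 = 0" "eval_xH x H 1 = 1"
  "eval_xH x H (numeral k) = numeral k"
  "eval_xH x H (const c) = of_rat c"
  "eval_xH x H var_x = of_rat x"
  "eval_xH x H var_H = of_rat H"
proof -
  interpret comm_ring_hom "eval_xH x H" by (rule eval_xH_hom)
  show "eval_xH x H (numeral k) = numeral k"
    using hom_of_nat[of "numeral k"] by simp
qed (simp_all add: eval_xH_def const_def var_x_def var_H_def of_rat_add of_rat_diff of_rat_mult
    of_rat_minus of_rat_power)

lemma eval_xH_cal_A4: "eval_xH x H (cal_A4 p q) = cal_A4 (eval_xH x H p) (eval_xH x H q)"
  by (simp add: cal_A4_def Let_def eval_xH_simps)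

lemma eval_xH_cal_B4: "eval_xH x H (cal_B4 p q) = cal_B4 (eval_xH x H p) (eval_xH x H q)"
  by (simp add: cal_B4_def eval_xH_simps)

text \<open>A nonzero polynomial in the outer variable has finitely many roots, but here every
  constant \<open>[:H:]\<close> would be one.\<close>

lemma eval_xH_eq_0_imp_eq_0:
  assumes "\<And>x H. eval_xH x H p = 0"
  shows "p = 0"
proof (rule ccontr)
  assume "p \<noteq> 0"
  hence "finite {q. poly p q = 0}" by (rule poly_roots_finite)
  moreover have "range (\<lambda>H. [:H:]) \<subseteq> {q. poly p q = 0}"
  proof (clarify)
    fix H :: rat
    have "poly (poly p [:H:]) x = 0" for x using assms[of x H] by (simp add: eval_xH_def)
    thus "poly p [:H:] = 0" by (simp flip: poly_all_0_iff_0)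
  qed
  ultimately have "finite (range (\<lambda>H::rat. [:H:]))" by (rule finite_subset[rotated])
  moreover have "inj (\<lambda>H::rat. [:H:])" by (rule injI) simp
  ultimately have "finite (UNIV :: rat set)" by (rule finite_imageD)
  thus False by (simp add: infinite_UNIV_char_0)
qed

text \<open>The powers of 3 clear the denominators; each is complementary to the factor in
  \<open>sextic_eq_reduced\<close>, so that the exponents add up to 18.\<close>

lemma eval_xH_coeffs:
  fixes x H :: rat
  defines "x' \<equiv> of_rat x :: complex" and "H' \<equiv> of_rat H :: complex"
  shows
    "3^13 * eval_xH x H (coeff_A0 var_x var_H) =
      - 2 * x'^3 * (1 + x')^8 * (x'^2 + x' + 1) * H' + 3 * x'^3 * (1 + x')^4 * (4*x'^4 + 24*x'^3 + 57*x'^2 +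
      57*x' + 33) * H'^2 - 6 * x'^3 * (4*x'^6 + 36*x'^5 - 585*x'^4 + 324*x'^3 - 135*x'^2 + 486*x' - 486) *
      H'^3 - 729 * x'^3 * (36*x'^2 + 36*x' - 31) * H'^4 + 52488 * x'^3 * H'^5"
    "3^12 * eval_xH x H (coeff_A1 var_x var_H) =
      1 * x'^2 * (1 + x')^9 * (x'^2 + x' + 1) - 6 * x'^2 * (1 + x')^5 * (2*x'^4 + 19*x'^3 + 29*x'^2 + 27*x'
      + 9) * H' + 9 * x'^2 * (1 + x') * (4*x'^6 + 68*x'^5 + 85*x'^4 + 729*x'^3 + 588*x'^2 + 513*x' - 135) *
      H'^2 - 324 * x'^2 * (2*x'^4 - 69*x'^3 - 51*x'^2 + 45*x' + 18) * H'^3 - 78732 * x'^3 * H'^4"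
    "3^10 * eval_xH x H (coeff_A2 var_x var_H) =
      1 * x' * (1 + x')^6 * (x'^4 + 13*x'^3 + 15*x'^2 + 13*x' + 1) - 6 * x' * (1 + x')^2 * (x'^6 + 25*x'^5 +
      138*x'^4 + 241*x'^3 + 226*x'^2 + 99*x' + 9) * H' + 27 * x' * (12*x'^5 + 27*x'^4 + 243*x'^3 + 422*x'^2
      + 171*x' - 45) * H'^2 + 486 * x' * (23*x'^2 - 12*x' - 12) * H'^3"
    "3^9 * eval_xH x H (coeff_A3 var_x var_H) =
      1 * (1 + x')^3 * (x'^6 + 33*x'^5 + 204*x'^4 + 263*x'^3 + 204*x'^2 + 33*x' + 1) - 54 * H' * (3*x'^6 +
      36*x'^5 + 126*x'^4 + 166*x'^3 + 114*x'^2 + 24*x' + 1) + 243 * (3*x'^3 + 48*x'^2 + 48*x' - 5) * H'^2 -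
      5832 * H'^3"
    "3^5 * eval_xH x H (coeff_A4 var_x var_H) =
      1 * (x'^6 + 15*x'^5 + 60*x'^4 + 83*x'^3 + 60*x'^2 + 15*x' + 1) - 18 * (3*x'^3 + 15*x'^2 + 15*x' + 2)
      * H' + 324 * H'^2"
    "3^2 * eval_xH x H (coeff_A5 var_x var_H) =
      1 * (1 + x') * (x'^2 + 5*x' + 1) - 18*H'"
  unfolding coeff_A0_def coeff_A1_def coeff_A2_def coeff_A3_def coeff_A4_def coeff_A5_def
    eval_xH_simps x'_def[symmetric] H'_def[symmetric]
  by (simp_all add: of_rat_divide field_simps)

lemma map_poly_eval_xH_P4:
  "map_poly (eval_xH x H) P4 = [:eval_xH x H (coeff_A0 var_x var_H),
    eval_xH x H (coeff_A1 var_x var_H), eval_xH x H (coeff_A2 var_x var_H),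
    eval_xH x H (coeff_A3 var_x var_H), eval_xH x H (coeff_A4 var_x var_H),
    eval_xH x H (coeff_A5 var_x var_H), 1:]"
  by (simp add: P4_def map_poly_pCons eval_xH_simps)

lemma poly_monic_sextic:
  fixes F :: "'a :: idom"
  shows "poly [:a0, a1, a2, a3, a4, a5, 1:] F = a0 + a1*F + a2*F^2 + a3*F^3 + a4*F^4 + a5*F^5 + F^6"
  unfolding poly_pCons poly_0 by Groebner_Basis.algebra

text \<open>Degree 6 gives the sign \<open>(-1)^15\<close>, and the leading coefficient is
  1.\<close>

lemma discriminant_P4: "discriminant P4 = - resultant P4 (pderiv P4)"
  by (simp add: discriminant_def P4_def)

lemma eval_xH_discriminant_P4:
  fixes x H :: rat
  defines "x' \<equiv> of_rat x :: complex" and "H' \<equiv> of_rat H :: complex"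
  assumes nz: "x' \<noteq> 0" "H' \<noteq> 0" "cal_A4 (x'^3) (9*H') \<noteq> 0" "cal_B4 (x'^3) H' \<noteq> 0"
  shows "eval_xH x H (discriminant P4)
    = 1 / 3^64 * H'^4 * x'^6 * cal_A4 (x'^3) (9*H')^3 * cal_B4 (x'^3) H'^2"
proof -
  interpret comm_ring_hom "eval_xH x H" by (rule eval_xH_hom)
  let ?p = "map_poly (eval_xH x H) P4"
  have deg: "degree ?p = 6" and monic: "monic ?p"
    by (simp_all add: map_poly_eval_xH_P4)
  have deg_P4: "degree P4 = 6" by (simp add: P4_def)
  have pderiv: "map_poly (eval_xH x H) (pderiv P4) = pderiv ?p"
    by (rule poly_eqI) (simp add: coeff_pderiv coeff_map_poly eval_xH_simps hom_of_nat del: of_nat_Suc)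
  \<comment> \<open>Evaluation preserves the degrees 6 and 5, so the Sylvester matrix keeps its
    shape.\<close>
  have "eval_xH x H (resultant P4 (pderiv P4)) = resultant ?p (pderiv ?p)"
    unfolding pderiv[symmetric]
    by (rule resultant_map_poly[symmetric]) (simp_all add: pderiv degree_pderiv deg deg_P4)
  also have "\<dots> = - (1 / 3^64 * H'^4 * x'^6 * cal_A4 (x'^3) (9*H')^3 * cal_B4 (x'^3) H'^2)"
  proof (rule resultant_pderiv_sextic[OF nz deg monic])
    fix F
    show "3^18 * poly ?p F = poly (reduced_poly (x'^3) (9*H')) (- ((1 + x')^3) - 27*F)"
      unfolding sextic_eq_reduced[symmetric]
        eval_xH_coeffs[of x H, folded x'_def H'_def, symmetric] map_poly_eval_xH_P4 poly_monic_sextic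
      by (simp add: algebra_simps)
  qed
  finally show ?thesis by (simp add: discriminant_P4 eval_xH_simps)
qed

theorem mainTheorem9:
  shows "discriminant P4 =
    const (1 / 3^64) * var_H^4 * var_x^6
      * (cal_A4 (var_x^3) (9 * var_H))^3 * (cal_B4 (var_x^3) var_H)^2"
    (is "?D = ?R")
proof -
  have R: "eval_xH x H ?R = 1 / 3^64 * of_rat H^4 * of_rat x^6
    * cal_A4 (of_rat x^3) (9 * of_rat H)^3 * cal_B4 (of_rat x^3) (of_rat H)^2" for x H
    by (simp add: eval_xH_simps eval_xH_cal_A4 eval_xH_cal_B4 of_rat_divide of_rat_power)
  \<comment> \<open>The factor \<open>?R\<close> disposes of the exceptional points: where it
    vanishes the product is 0, and elsewhere all genericity conditions hold.\<close>
  have "(?D - ?R) * ?R = 0"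
  proof (rule eval_xH_eq_0_imp_eq_0)
    fix x H
    have "eval_xH x H ?D = eval_xH x H ?R" if "eval_xH x H ?R \<noteq> 0"
      using that unfolding R by (intro eval_xH_discriminant_P4) auto
    moreover have "eval_xH x H ((?D - ?R) * ?R) = (eval_xH x H ?D - eval_xH x H ?R) * eval_xH x H ?R"
      by (simp only: eval_xH_simps(2,3))
    ultimately show "eval_xH x H ((?D - ?R) * ?R) = 0" by (metis cancel_comm_monoid_add_class.diff_cancel mult_eq_0_iff)
  qed
  moreover have "?R \<noteq> 0"
  proof
    assume "?R = 0"
    hence "eval_xH 1 1 ?R = 0" by (simp only: eval_xH_simps)
    thus False unfolding R by (simp add: cal_A4_def cal_B4_def)
  qed
  ultimately show ?thesis by simp
qed

end
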